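(* Let $\mathcal E: 0\to A\xrightarrow{j}B\xrightarrow{p}G\to 0$, together with $\beta:B_0\to B$, be an $(\alpha,\gamma)$-prolongation of $\mathcal E_0: 0\to A_0\xrightarrow{j_0}B_0\xrightarrow{p_0}G_0\to 0$. Let $E_0=B_0/j_0(\Ker\alpha)$, let $\pi:E_0\to G_0$ be $\pi(b_0+j_0\Ker\alpha)=p_0(b_0)$, and let $\varepsilon:E_0\to B$ be the injective homomorphism $\varepsilon(b_0+j_0\Ker\alpha)=\beta(b_0)$. Then the prolongation induces a group homomorphism $\theta:G\to\operatorname{Aut}E_0$, $g\mapsto\theta_g$, well defined by $$\theta_g(e)=\varepsilon^{-1}\bigl(b+\varepsilon(e)-b\bigr)\qquad (e\in E_0,\ b\in B \text{ any element with } p(b)=g),$$ and the quadruple $(E_0,G,\gamma\pi,\theta)$ is a crossed module.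
   Context: Groups are written additively even when non-abelian. $(\alpha,\gamma)$-prolongation: Let $\mathcal E_0: 0\to A_0\xrightarrow{j_0}B_0\xrightarrow{p_0}G_0\to 0$ be a short exact sequence of groups with $j_0A_0$ contained in the center of $B_0$, let $\alpha:A_0\to A$ be a surjective group homomorphism, and let $\gamma:G_0\to G$ be an injective group homomorphism whose image is a normal subgroup of $G$. An $(\alpha,\gamma)$-prolongation of $\mathcal E_0$ is a short exact sequence of groups $\mathcal E: 0\to A\xrightarrow{j}B\xrightarrow{p}G\to 0$ together with a homomorphism $\beta:B_0\to B$ such that $\beta j_0=j\alpha$ and $p\beta=\gamma p_0$. Crossed module: a quadruple $(B,D,d,\theta)$ with group homomorphisms $d:B\to D$ and $\theta:D\to\operatorname{Aut}B$ such that $\theta_{d(b)}=\mu_b$ for all $b\in B$, and $d(\theta_x(b))=\mu_x(d(b))$ for all $x\in D$, $b\in B$, where $\mu_x$ denotes conjugation by $x$ (i.e. $\mu_x(y)=x+y-x$). *)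

theory Defs
  imports "HOL-Algebra.Coset" "HOL-Algebra.Bij" "HOL-Algebra.Exact_Sequence"
begin

text \<open>
  Groups are written multiplicatively, as in HOL-Algebra; they need not be abelian.
  The sequence \<open>0 \<rightarrow> A \<rightarrow> B \<rightarrow> G \<rightarrow> 0\<close> is described directly because
  \<^const>\<open>short_exact_sequence\<close> forces all groups of a sequence to have one element type.
\<close>

definition short_exact ::
  "('a, _) monoid_scheme \<Rightarrow> ('a \<Rightarrow> 'b) \<Rightarrow> ('b, _) monoid_scheme \<Rightarrow> ('b \<Rightarrow> 'g) \<Rightarrow>
   ('g, _) monoid_scheme \<Rightarrow> bool"
  where "short_exact A j B p G \<longleftrightarrow>
    group A \<and> group B \<and> group G \<and> j \<in> mon A B \<and> p \<in> epi B G \<and>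
    j ` carrier A = kernel B G p"

definition group_center :: "('a, _) monoid_scheme \<Rightarrow> 'a set"
  where "group_center G =
    {z \<in> carrier G. \<forall>x \<in> carrier G. z \<otimes>\<^bsub>G\<^esub> x = x \<otimes>\<^bsub>G\<^esub> z}"

text \<open>The data of which one considers prolongations: a central extension together with a
  surjection \<open>\<alpha>\<close> out of its kernel and a normal embedding \<open>\<gamma>\<close> of its quotient.\<close>

definition prolongation_problem ::
  "('a0, _) monoid_scheme \<Rightarrow> ('a0 \<Rightarrow> 'b0) \<Rightarrow> ('b0, _) monoid_scheme \<Rightarrow> ('b0 \<Rightarrow> 'g0) \<Rightarrow>
   ('g0, _) monoid_scheme \<Rightarrow> ('a, _) monoid_scheme \<Rightarrow> ('g, _) monoid_scheme \<Rightarrow>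
   ('a0 \<Rightarrow> 'a) \<Rightarrow> ('g0 \<Rightarrow> 'g) \<Rightarrow> bool"
  where "prolongation_problem A0 j0 B0 p0 G0 A G \<alpha> \<gamma> \<longleftrightarrow>
    short_exact A0 j0 B0 p0 G0 \<and> j0 ` carrier A0 \<subseteq> group_center B0 \<and>
    group A \<and> \<alpha> \<in> epi A0 A \<and>
    group G \<and> \<gamma> \<in> mon G0 G \<and> \<gamma> ` carrier G0 \<lhd> G"

definition prolongation ::
  "('a0, _) monoid_scheme \<Rightarrow> ('a0 \<Rightarrow> 'b0) \<Rightarrow> ('b0, _) monoid_scheme \<Rightarrow> ('b0 \<Rightarrow> 'g0) \<Rightarrow>
   ('g0, _) monoid_scheme \<Rightarrow> ('a0 \<Rightarrow> 'a) \<Rightarrow> ('g0 \<Rightarrow> 'g) \<Rightarrow>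
   ('a, _) monoid_scheme \<Rightarrow> ('a \<Rightarrow> 'b) \<Rightarrow> ('b, _) monoid_scheme \<Rightarrow> ('b \<Rightarrow> 'g) \<Rightarrow>
   ('g, _) monoid_scheme \<Rightarrow> ('b0 \<Rightarrow> 'b) \<Rightarrow> bool"
  where "prolongation A0 j0 B0 p0 G0 \<alpha> \<gamma> A j B p G \<beta> \<longleftrightarrow>
    prolongation_problem A0 j0 B0 p0 G0 A G \<alpha> \<gamma> \<and>
    short_exact A j B p G \<and> \<beta> \<in> hom B0 B \<and>
    (\<forall>a \<in> carrier A0. \<beta> (j0 a) = j (\<alpha> a)) \<and>
    (\<forall>b \<in> carrier B0. p (\<beta> b) = \<gamma> (p0 b))"

definition crossed_module ::
  "('b, _) monoid_scheme \<Rightarrow> ('d, _) monoid_scheme \<Rightarrow> ('b \<Rightarrow> 'd) \<Rightarrow> ('d \<Rightarrow> 'b \<Rightarrow> 'b) \<Rightarrow> bool"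
  where "crossed_module B D d \<theta> \<longleftrightarrow>
    group B \<and> group D \<and> d \<in> hom B D \<and> \<theta> \<in> hom D (AutoGroup B) \<and>
    (\<forall>b \<in> carrier B. \<forall>c \<in> carrier B. \<theta> (d b) c = b \<otimes>\<^bsub>B\<^esub> c \<otimes>\<^bsub>B\<^esub> inv\<^bsub>B\<^esub> b) \<and>
    (\<forall>x \<in> carrier D. \<forall>b \<in> carrier B. d (\<theta> x b) = x \<otimes>\<^bsub>D\<^esub> d b \<otimes>\<^bsub>D\<^esub> inv\<^bsub>D\<^esub> x)"

text \<open>The map on cosets induced by \<open>f\<close>; meaningful when \<open>f\<close> is constant on each coset.\<close>

definition coset_map :: "('b \<Rightarrow> 'c) \<Rightarrow> 'b set \<Rightarrow> 'c"
  where "coset_map f C = the_elem (f ` C)"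

text \<open>Conjugation by some \<open>p\<close>-preimage of \<open>g\<close>, pulled back along \<open>\<epsilon>\<close>. The preimage is an
  arbitrary choice, so independence of it has to be established separately. The map is
  restricted to the carrier because elements of \<^const>\<open>AutoGroup\<close> are extensional.\<close>

definition conj_action ::
  "('b, _) monoid_scheme \<Rightarrow> ('b \<Rightarrow> 'g) \<Rightarrow> ('e, _) monoid_scheme \<Rightarrow> ('e \<Rightarrow> 'b) \<Rightarrow> 'g \<Rightarrow> 'e \<Rightarrow> 'e"
  where "conj_action B p E \<epsilon> g =
    (let b = (SOME b. b \<in> carrier B \<and> p b = g)
     in (\<lambda>e \<in> carrier E. inv_into (carrier E) \<epsilon> (b \<otimes>\<^bsub>B\<^esub> \<epsilon> e \<otimes>\<^bsub>B\<^esub> inv\<^bsub>B\<^esub> b)))"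

end

theory Submission
  imports Defs
begin

text \<open>
  Since \<open>p \<beta> = \<gamma> p\<^sub>0\<close> with \<open>\<gamma>\<close> and \<open>j\<close> injective, \<open>j\<^sub>0 (Ker \<alpha>)\<close> is exactly the kernel of \<open>\<beta>\<close>,
  so \<open>\<epsilon>\<close> is the embedding given by the first isomorphism theorem. Surjectivity of \<open>\<alpha>\<close> makes
  the image of \<open>\<beta>\<close> the full \<open>p\<close>-preimage of the normal subgroup \<open>\<gamma> G\<^sub>0\<close>, hence stable under
  conjugation, and it makes \<open>j A = \<beta> (j\<^sub>0 A\<^sub>0)\<close>, which centralises \<open>\<beta> B\<^sub>0\<close> because \<open>j\<^sub>0 A\<^sub>0\<close> is
  central. Thus conjugation of \<open>\<beta> B\<^sub>0\<close> by an element of \<open>B\<close> depends only on its class in \<open>G\<close>.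
\<close>

section \<open>Homomorphisms induced on a quotient group\<close>

lemma coset_map_r_coset:
  assumes "group_hom G H h" and N: "N \<lhd> G" "N \<subseteq> kernel G H h" and x: "x \<in> carrier G"
  shows "coset_map h (N #>\<^bsub>G\<^esub> x) = h x"
proof -
  interpret group_hom G H h by fact
  have "h y = h x" if "y \<in> N #>\<^bsub>G\<^esub> x" for y
    using that N(2) x by (auto simp: r_coset_def kernel_def)
  moreover have "x \<in> N #>\<^bsub>G\<^esub> x"
    using N(1) x by (simp add: G.rcos_self normal_imp_subgroup)
  ultimately have "h ` (N #>\<^bsub>G\<^esub> x) = {h x}" by blast
  then show ?thesis by (simp add: coset_map_def)
qed

text \<open>The universal property of the quotient only asserts that some induced homomorphism
  exists. \<open>coset_map h\<close> agrees with it on every coset, and this agreement carries the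
  homomorphism property over.\<close>

lemma coset_map_hom:
  assumes "group_hom G H h" and N: "N \<lhd> G" "N \<subseteq> kernel G H h"
  shows "coset_map h \<in> hom (G Mod N) H"
proof -
  interpret group_hom G H h by fact
  obtain g where g: "g \<in> hom (G Mod N) H" "\<And>x. x \<in> carrier G \<Longrightarrow> g (N #>\<^bsub>G\<^esub> x) = h x"
    using FactGroup_universal_kernel[OF N] by blast
  have "coset_map h X = g X" if "X \<in> carrier (G Mod N)" for X
    using that g(2) coset_map_r_coset[OF assms] by (auto simp: carrier_FactGroup)
  moreover have "group (G Mod N)"
    using N(1) by (rule normal.factorgroup_is_group)
  ultimately show ?thesis
    using g(1) by (simp add: hom_def Pi_iff group.is_monoid monoid.m_closed del: mult_FactGroup)
qed

section \<open>Conjugation action on an embedded, conjugation-stable group\<close>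

text \<open>Stability makes the pull-back of conjugation along \<epsilon> meaningful; centralisation
  by the kernel of \<open>p\<close> makes it depend only on the class in \<open>G\<close>.\<close>

locale conjugation_stable_embedding =
  E: group E + B: group B + G: group G
  for E :: "('e, 'm) monoid_scheme" and B :: "('b, 'n) monoid_scheme"
    and G :: "('g, 'o) monoid_scheme" and \<epsilon> :: "'e \<Rightarrow> 'b" and p :: "'b \<Rightarrow> 'g" +
  assumes \<epsilon>_mon: "\<epsilon> \<in> mon E B"
    and p_epi: "p \<in> epi B G"
    and conj_stable:
      "\<lbrakk>b \<in> carrier B; e \<in> carrier E\<rbrakk> \<Longrightarrow> b \<otimes>\<^bsub>B\<^esub> \<epsilon> e \<otimes>\<^bsub>B\<^esub> inv\<^bsub>B\<^esub> b \<in> \<epsilon> ` carrier E"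
    and kernel_centralises:
      "\<lbrakk>k \<in> kernel B G p; e \<in> carrier E\<rbrakk> \<Longrightarrow> k \<otimes>\<^bsub>B\<^esub> \<epsilon> e = \<epsilon> e \<otimes>\<^bsub>B\<^esub> k"
begin

sublocale \<epsilon>: group_hom E B \<epsilon>
  using \<epsilon>_mon by unfold_locales (simp add: mon_def)

sublocale p: group_hom B G p
  using p_epi by unfold_locales (simp add: epi_def)

abbreviation \<theta> :: "'g \<Rightarrow> 'e \<Rightarrow> 'e"
  where "\<theta> \<equiv> conj_action B p E \<epsilon>"

lemma \<epsilon>_inj: "inj_on \<epsilon> (carrier E)"
  using \<epsilon>_mon by (simp add: mon_def)

lemma p_lift:
  assumes "g \<in> carrier G"
  obtains b where "b \<in> carrier B" "p b = g"
proof -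
  have "g \<in> p ` carrier B"
    using p_epi assms by (simp add: epi_def)
  then show thesis
    using that by blast
qed

text \<open>The two elements differ by a factor in the kernel of \<open>p\<close>, which commutes
  with \<open>\<epsilon> e\<close> and so cancels.\<close>

lemma conj_eq_if_p_eq:
  assumes b: "b \<in> carrier B" and c: "c \<in> carrier B" and pbc: "p b = p c"
    and e: "e \<in> carrier E"
  shows "b \<otimes>\<^bsub>B\<^esub> \<epsilon> e \<otimes>\<^bsub>B\<^esub> inv\<^bsub>B\<^esub> b = c \<otimes>\<^bsub>B\<^esub> \<epsilon> e \<otimes>\<^bsub>B\<^esub> inv\<^bsub>B\<^esub> c"
proof -
  define k where "k = inv\<^bsub>B\<^esub> c \<otimes>\<^bsub>B\<^esub> b"
  have k: "k \<in> carrier B" "k \<in> kernel B G p"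
    using b c pbc by (simp_all add: k_def kernel_def)
  have bk: "b = c \<otimes>\<^bsub>B\<^esub> k"
    using b c by (simp add: k_def B.m_assoc[symmetric])
  have "k \<otimes>\<^bsub>B\<^esub> \<epsilon> e \<otimes>\<^bsub>B\<^esub> inv\<^bsub>B\<^esub> k = \<epsilon> e"
    using k e by (simp add: kernel_centralises B.m_assoc)
  moreover have "b \<otimes>\<^bsub>B\<^esub> \<epsilon> e \<otimes>\<^bsub>B\<^esub> inv\<^bsub>B\<^esub> b
      = c \<otimes>\<^bsub>B\<^esub> (k \<otimes>\<^bsub>B\<^esub> \<epsilon> e \<otimes>\<^bsub>B\<^esub> inv\<^bsub>B\<^esub> k) \<otimes>\<^bsub>B\<^esub> inv\<^bsub>B\<^esub> c"
    using k c e by (simp add: bk B.inv_mult_group B.m_assoc)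
  ultimately show ?thesis by simp
qed

text \<open>This removes the arbitrary choice in \<open>conj_action\<close>: any preimage may
  replace the chosen one.\<close>

lemma conj_action_eq:
  assumes b: "b \<in> carrier B" and e: "e \<in> carrier E"
  shows "\<theta> (p b) e = inv_into (carrier E) \<epsilon> (b \<otimes>\<^bsub>B\<^esub> \<epsilon> e \<otimes>\<^bsub>B\<^esub> inv\<^bsub>B\<^esub> b)"
proof -
  define c where "c = (SOME c. c \<in> carrier B \<and> p c = p b)"
  have "c \<in> carrier B \<and> p c = p b"
    unfolding c_def by (rule someI[of _ b]) (simp add: b)
  then show ?thesis
    using conj_eq_if_p_eq[of c b e] b e
    by (simp add: conj_action_def c_def[symmetric])
qed

lemma conj_action_closed [simp]:
  assumes "g \<in> carrier G" "e \<in> carrier E"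
  shows "\<theta> g e \<in> carrier E"
proof -
  obtain b where b: "b \<in> carrier B" "p b = g" using p_lift assms(1) by blast
  show ?thesis
    unfolding b(2)[symmetric] conj_action_eq[OF b(1) assms(2)]
    by (rule inv_into_into[OF conj_stable[OF b(1) assms(2)]])
qed

lemma \<epsilon>_conj_action:
  assumes "b \<in> carrier B" "e \<in> carrier E"
  shows "\<epsilon> (\<theta> (p b) e) = b \<otimes>\<^bsub>B\<^esub> \<epsilon> e \<otimes>\<^bsub>B\<^esub> inv\<^bsub>B\<^esub> b"
  using assms by (simp add: conj_action_eq conj_stable f_inv_into_f)

text \<open>By injectivity of \<epsilon>, an identity about \<theta> can be checked in
  \<open>B\<close>, with a preimage of one's own choosing. The algebraic laws of \<theta> below are
  obtained this way.\<close>

lemma conj_action_unique: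
  assumes "b \<in> carrier B" "e \<in> carrier E" "x \<in> carrier E"
    and "\<epsilon> x = b \<otimes>\<^bsub>B\<^esub> \<epsilon> e \<otimes>\<^bsub>B\<^esub> inv\<^bsub>B\<^esub> b"
  shows "\<theta> (p b) e = x"
proof (rule inj_onD[OF \<epsilon>_inj])
  show "\<epsilon> (\<theta> (p b) e) = \<epsilon> x"
    unfolding \<epsilon>_conj_action[OF assms(1,2)] assms(4) ..
qed (use assms in simp_all)

lemma conj_action_mult:
  assumes "g \<in> carrier G" "x \<in> carrier E" "y \<in> carrier E"
  shows "\<theta> g (x \<otimes>\<^bsub>E\<^esub> y) = \<theta> g x \<otimes>\<^bsub>E\<^esub> \<theta> g y"
proof -
  obtain b where b: "b \<in> carrier B" "p b = g" using p_lift assms(1) by blast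
  \<comment> \<open>With products associated to the right, this cancels the inner factors between
    the two conjugates.\<close>
  have [simp]: "inv\<^bsub>B\<^esub> b \<otimes>\<^bsub>B\<^esub> (b \<otimes>\<^bsub>B\<^esub> z) = z" if "z \<in> carrier B" for z
    using that b by (simp add: B.m_assoc[symmetric])
  have "\<theta> (p b) (x \<otimes>\<^bsub>E\<^esub> y) = \<theta> (p b) x \<otimes>\<^bsub>E\<^esub> \<theta> (p b) y"
    using assms b(1) by (intro conj_action_unique) (simp_all add: \<epsilon>_conj_action B.m_assoc)
  then show ?thesis by (simp add: b)
qed

lemma conj_action_comp:
  assumes "g \<in> carrier G" "h \<in> carrier G" "e \<in> carrier E"
  shows "\<theta> (g \<otimes>\<^bsub>G\<^esub> h) e = \<theta> g (\<theta> h e)"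
proof -
  obtain b c where b: "b \<in> carrier B" "p b = g" and c: "c \<in> carrier B" "p c = h"
    using p_lift assms(1,2) by metis
  \<comment> \<open>The product of the preimages is a preimage of the product, and conjugation by it
    is the composite of the two conjugations.\<close>
  have "\<theta> (p (b \<otimes>\<^bsub>B\<^esub> c)) e = \<theta> (p b) (\<theta> (p c) e)"
    using assms b(1) c(1)
    by (intro conj_action_unique) (simp_all add: \<epsilon>_conj_action B.m_assoc B.inv_mult_group)
  then show ?thesis using b c by simp
qed

lemma conj_action_one:
  assumes "e \<in> carrier E"
  shows "\<theta> \<one>\<^bsub>G\<^esub> e = e"
proof -
  have "\<theta> (p \<one>\<^bsub>B\<^esub>) e = e"
    using assms by (intro conj_action_unique) simp_all
  then show ?thesis by simp
qed

lemma conj_action_auto: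
  assumes g: "g \<in> carrier G"
  shows "\<theta> g \<in> auto E"
proof -
  have "bij_betw (\<theta> g) (carrier E) (carrier E)"
    \<comment> \<open>The action of the inverse element is a two-sided inverse, since both
      composites are the action of the identity.\<close>
    by (rule bij_betw_byWitness[where f' = "\<theta> (inv\<^bsub>G\<^esub> g)"])
      (use g in \<open>auto simp: conj_action_comp[symmetric] conj_action_one\<close>)
  moreover have "\<theta> g \<in> extensional (carrier E)"
    by (simp add: conj_action_def Let_def)
  moreover have "\<theta> g \<in> hom E E"
    using g by (intro homI) (simp_all add: conj_action_mult)
  ultimately show ?thesis
    by (simp add: auto_def Bij_def)
qed

lemma conj_action_hom: "\<theta> \<in> hom G (AutoGroup E)"
proof (rule homI)
  fix g h assume gh: "g \<in> carrier G" "h \<in> carrier G"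
  then have "\<theta> g \<in> Bij (carrier E)" "\<theta> h \<in> Bij (carrier E)"
    using conj_action_auto by (simp_all add: auto_def)
  \<comment> \<open>Elements of \<open>AutoGroup E\<close> are compared as functions; since both
    sides are extensional, agreement on the carrier suffices.\<close>
  moreover have "\<theta> (g \<otimes>\<^bsub>G\<^esub> h) = compose (carrier E) (\<theta> g) (\<theta> h)"
  proof (rule extensionalityI)
    show "\<theta> (g \<otimes>\<^bsub>G\<^esub> h) \<in> extensional (carrier E)"
      by (simp add: conj_action_def Let_def)
  qed (use gh in \<open>simp_all add: compose_def conj_action_comp\<close>)
  ultimately show "\<theta> (g \<otimes>\<^bsub>G\<^esub> h) = \<theta> g \<otimes>\<^bsub>AutoGroup E\<^esub> \<theta> h"
    by (simp add: AutoGroup_def BijGroup_def)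
qed (simp add: AutoGroup_def conj_action_auto)

text \<open>For the first identity, \<open>\<epsilon> b\<close> is a preimage of \<open>d b\<close>,
  and conjugation by it pulls back to conjugation by \<open>b\<close>. For the second, apply
  \<open>p\<close> to \<open>\<epsilon>_conj_action\<close>.\<close>

lemma conj_action_crossed_module:
  assumes d: "\<And>e. e \<in> carrier E \<Longrightarrow> d e = p (\<epsilon> e)"
  shows "crossed_module E G d \<theta>"
proof -
  have "d \<in> hom E G"
    by (rule homI) (simp_all add: d)
  moreover have "\<theta> (d b) c = b \<otimes>\<^bsub>E\<^esub> c \<otimes>\<^bsub>E\<^esub> inv\<^bsub>E\<^esub> b"
    if "b \<in> carrier E" "c \<in> carrier E" for b c
    using that unfolding d[OF that(1)] by (intro conj_action_unique) simp_all
  moreover have "d (\<theta> x b) = x \<otimes>\<^bsub>G\<^esub> d b \<otimes>\<^bsub>G\<^esub> inv\<^bsub>G\<^esub> x"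
    if x: "x \<in> carrier G" and b: "b \<in> carrier E" for x b
  proof -
    obtain c where "c \<in> carrier B" "p c = x" using p_lift x by blast
    then show ?thesis using x b \<epsilon>_conj_action[of c b] by (simp add: d)
  qed
  ultimately show ?thesis
    by (simp add: crossed_module_def conj_action_hom)
qed

end

section \<open>The crossed module of a prolongation\<close>

theorem theorem2p3:
  fixes A0 :: "('a0, 'a0x) monoid_scheme" and B0 :: "('b0, 'b0x) monoid_scheme"
    and G0 :: "('g0, 'g0x) monoid_scheme" and A :: "('a, 'ax) monoid_scheme"
    and B :: "('b, 'bx) monoid_scheme" and G :: "('g, 'gx) monoid_scheme"
    and j0 :: "'a0 \<Rightarrow> 'b0" and p0 :: "'b0 \<Rightarrow> 'g0" and j :: "'a \<Rightarrow> 'b" and p :: "'b \<Rightarrow> 'g"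
    and \<alpha> :: "'a0 \<Rightarrow> 'a" and \<beta> :: "'b0 \<Rightarrow> 'b" and \<gamma> :: "'g0 \<Rightarrow> 'g"
    and K :: "'b0 set" and E0 :: "'b0 set monoid"
    and \<pi> :: "'b0 set \<Rightarrow> 'g0" and \<epsilon> :: "'b0 set \<Rightarrow> 'b" and \<theta> :: "'g \<Rightarrow> 'b0 set \<Rightarrow> 'b0 set"
  assumes prol: "prolongation A0 j0 B0 p0 G0 \<alpha> \<gamma> A j B p G \<beta>"
    and K: "K = j0 ` kernel A0 A \<alpha>"
    and E0: "E0 = B0 Mod K"
    and \<pi>: "\<pi> = coset_map p0"
    and \<epsilon>: "\<epsilon> = coset_map \<beta>"
    and \<theta>: "\<theta> = conj_action B p E0 \<epsilon>"
  shows "K \<lhd> B0 \<and>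
    \<pi> \<in> hom E0 G0 \<and> (\<forall>b0 \<in> carrier B0. \<pi> (b0 <#\<^bsub>B0\<^esub> K) = p0 b0) \<and>
    \<epsilon> \<in> mon E0 B \<and> (\<forall>b0 \<in> carrier B0. \<epsilon> (b0 <#\<^bsub>B0\<^esub> K) = \<beta> b0) \<and>
    \<theta> \<in> hom G (AutoGroup E0) \<and>
    (\<forall>g \<in> carrier G. \<forall>b \<in> carrier B. p b = g \<longrightarrow> (\<forall>e \<in> carrier E0.
       b \<otimes>\<^bsub>B\<^esub> \<epsilon> e \<otimes>\<^bsub>B\<^esub> inv\<^bsub>B\<^esub> b \<in> \<epsilon> ` carrier E0 \<and>
       \<theta> g e = inv_into (carrier E0) \<epsilon> (b \<otimes>\<^bsub>B\<^esub> \<epsilon> e \<otimes>\<^bsub>B\<^esub> inv\<^bsub>B\<^esub> b))) \<and>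
    crossed_module E0 G (\<gamma> \<circ> \<pi>) \<theta>"
proof -
  have ex0: "short_exact A0 j0 B0 p0 G0" and ex: "short_exact A j B p G"
    and central: "j0 ` carrier A0 \<subseteq> group_center B0"
    and \<alpha>_epi: "\<alpha> \<in> epi A0 A" and \<gamma>_mon: "\<gamma> \<in> mon G0 G" and \<gamma>_normal: "\<gamma> ` carrier G0 \<lhd> G"
    and \<beta>_hom: "\<beta> \<in> hom B0 B"
    and \<beta>j0: "\<And>a. a \<in> carrier A0 \<Longrightarrow> \<beta> (j0 a) = j (\<alpha> a)"
    and p\<beta>: "\<And>b. b \<in> carrier B0 \<Longrightarrow> p (\<beta> b) = \<gamma> (p0 b)"
    using prol unfolding prolongation_def prolongation_problem_def by blast+
  have grp: "group A0" "group B0" "group G0" "group A" "group B" "group G"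
    and j0_ker: "j0 ` carrier A0 = kernel B0 G0 p0" and j_ker: "j ` carrier A = kernel B G p"
    and p0_epi: "p0 \<in> epi B0 G0" and p_epi: "p \<in> epi B G" and j_mon: "j \<in> mon A B"
    and j0_mon: "j0 \<in> mon A0 B0"
    using ex0 ex by (simp_all add: short_exact_def)
  interpret B: group B by fact
  interpret G: group G by fact
  interpret p0: group_hom B0 G0 p0
    using grp p0_epi by (simp add: group_hom_def group_hom_axioms_def epi_def)
  interpret p: group_hom B G p
    using grp p_epi by (simp add: group_hom_def group_hom_axioms_def epi_def)
  interpret \<beta>: group_hom B0 B \<beta>
    using grp \<beta>_hom by (simp add: group_hom_def group_hom_axioms_def)
  interpret \<gamma>: group_hom G0 G \<gamma>
    using grp \<gamma>_mon by (simp add: group_hom_def group_hom_axioms_def mon_def)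
  interpret j: group_hom A B j
    using grp j_mon by (simp add: group_hom_def group_hom_axioms_def mon_def)
  have j0_closed: "j0 a \<in> carrier B0" if "a \<in> carrier A0" for a
    using that j0_mon by (auto simp: mon_def hom_def)
  have \<gamma>_one: "x = \<one>\<^bsub>G0\<^esub>" if "x \<in> carrier G0" "\<gamma> x = \<one>\<^bsub>G\<^esub>" for x
    using that \<gamma>_mon grp by (auto simp: mon_iff_hom_one)
  have j_one: "a = \<one>\<^bsub>A\<^esub>" if "a \<in> carrier A" "j a = \<one>\<^bsub>B\<^esub>" for a
    using that j_mon grp by (auto simp: mon_iff_hom_one)
  have \<alpha>_closed: "\<alpha> a \<in> carrier A" if "a \<in> carrier A0" for a
    using that \<alpha>_epi by (auto simp: epi_def hom_def)
  \<comment> \<open>Surjectivity of \<alpha> lifts the kernel of \<open>p\<close>, which is the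
    image of \<open>j\<close>, back to \<open>A0\<close>.\<close>
  have ker_p: "\<exists>a \<in> carrier A0. k = \<beta> (j0 a)" if "k \<in> kernel B G p" for k
  proof -
    have "k \<in> j ` \<alpha> ` carrier A0"
      using that j_ker \<alpha>_epi by (simp add: epi_def)
    then show ?thesis using \<beta>j0 by auto
  qed

  have K_ker: "K = kernel B0 B \<beta>"
  proof
    show "K \<subseteq> kernel B0 B \<beta>"
      by (auto simp: K kernel_def \<beta>j0 j0_closed)
    show "kernel B0 B \<beta> \<subseteq> K"
    proof
      fix b assume "b \<in> kernel B0 B \<beta>"
      then have b: "b \<in> carrier B0" "\<beta> b = \<one>\<^bsub>B\<^esub>" by (simp_all add: kernel_def)
      \<comment> \<open>Injectivity of \<gamma> places \<open>b\<close> in the image of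
        \<open>j0\<close>; injectivity of \<open>j\<close> then places its preimage in the kernel of
        \<alpha>.\<close>
      then have "p0 b = \<one>\<^bsub>G0\<^esub>"
        using p\<beta>[of b] by (intro \<gamma>_one) simp_all
      then have "b \<in> j0 ` carrier A0"
        using b by (simp add: j0_ker kernel_def)
      then obtain a where a: "a \<in> carrier A0" "b = j0 a" by blast
      then have "\<alpha> a = \<one>\<^bsub>A\<^esub>"
        using b \<beta>j0[of a] by (intro j_one \<alpha>_closed) simp_all
      then show "b \<in> K"
        using a by (simp add: K kernel_def)
    qed
  qed
  have K_normal: "K \<lhd> B0"
    unfolding K_ker by (rule \<beta>.normal_kernel)
  have K_p0: "K \<subseteq> kernel B0 G0 p0"
    using j0_ker by (auto simp: K kernel_def)
  \<comment> \<open>The claim uses left cosets while \<open>B0 Mod K\<close> consists of right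
    cosets; normality identifies them.\<close>
  have lcos: "b <#\<^bsub>B0\<^esub> K = K #>\<^bsub>B0\<^esub> b" if "b \<in> carrier B0" for b
    using normal.coset_eq[OF K_normal] that by simp
  have carrier_E0: "carrier E0 = (\<lambda>b. K #>\<^bsub>B0\<^esub> b) ` carrier B0"
    by (simp add: E0 carrier_FactGroup)

  have \<pi>_coset: "\<pi> (K #>\<^bsub>B0\<^esub> b) = p0 b" if "b \<in> carrier B0" for b
    unfolding \<pi> using coset_map_r_coset[OF p0.group_hom_axioms K_normal K_p0 that] .
  have \<pi>_hom: "\<pi> \<in> hom E0 G0"
    unfolding \<pi> E0 using coset_map_hom[OF p0.group_hom_axioms K_normal K_p0] .
  have \<epsilon>_coset: "\<epsilon> (K #>\<^bsub>B0\<^esub> b) = \<beta> b" if "b \<in> carrier B0" for b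
    unfolding \<epsilon> using coset_map_r_coset[OF \<beta>.group_hom_axioms K_normal _ that] K_ker by simp
  have \<epsilon>_mon: "\<epsilon> \<in> mon E0 B"
    \<comment> \<open>Unfolded, \<open>coset_map \<beta>\<close> is literally the map of the first
      isomorphism theorem for \<beta>.\<close>
    using \<beta>.FactGroup_hom \<beta>.FactGroup_inj_on
    by (simp add: mon_def \<epsilon> E0 K_ker coset_map_def[abs_def])
  have \<epsilon>_image: "\<epsilon> ` carrier E0 = \<beta> ` carrier B0"
    by (auto simp: carrier_E0 image_image \<epsilon>_coset)

  have preimage: "b \<in> \<beta> ` carrier B0" if b: "b \<in> carrier B" and pb: "p b \<in> \<gamma> ` carrier G0" for b
  proof -
    have "p b \<in> \<gamma> ` p0 ` carrier B0"
      using pb p0_epi by (simp add: epi_def)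
    then obtain c where c: "c \<in> carrier B0" "p b = \<gamma> (p0 c)" by blast
    \<comment> \<open>Here \<open>\<beta> c\<close> has the same image under \<open>p\<close> as
      \<open>b\<close>, so the discrepancy lies in the kernel of \<open>p\<close> and comes from
      \<open>j0 a\<close>; multiplying \<open>c\<close> by \<open>j0 a\<close> corrects it.\<close>
    then have "inv\<^bsub>B\<^esub> (\<beta> c) \<otimes>\<^bsub>B\<^esub> b \<in> kernel B G p"
      using b by (simp add: kernel_def p\<beta>)
    then obtain a where a: "a \<in> carrier A0" "inv\<^bsub>B\<^esub> (\<beta> c) \<otimes>\<^bsub>B\<^esub> b = \<beta> (j0 a)"
      using ker_p by blast
    then have "b = \<beta> (c \<otimes>\<^bsub>B0\<^esub> j0 a)"
      using b c by (simp add: j0_closed B.m_assoc[symmetric] flip: a(2))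
    then show ?thesis
      using a c j0_closed by blast
  qed

  interpret E0: group E0
    unfolding E0 using K_normal by (rule normal.factorgroup_is_group)
  interpret conjugation_stable_embedding E0 B G \<epsilon> p
  proof
    show "\<epsilon> \<in> mon E0 B" "p \<in> epi B G" by fact+
  next
    fix b e assume b: "b \<in> carrier B" and "e \<in> carrier E0"
    then obtain c where c: "c \<in> carrier B0" "\<epsilon> e = \<beta> c"
      by (auto simp: carrier_E0 \<epsilon>_coset)
    \<comment> \<open>Stability is checked in \<open>G\<close>, where normality of the image of
      \<gamma> applies, and \<open>preimage\<close> brings it back to \<open>B\<close>.\<close>
    have "p (b \<otimes>\<^bsub>B\<^esub> \<beta> c \<otimes>\<^bsub>B\<^esub> inv\<^bsub>B\<^esub> b) = p b \<otimes>\<^bsub>G\<^esub> \<gamma> (p0 c) \<otimes>\<^bsub>G\<^esub> inv\<^bsub>G\<^esub> (p b)"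
      using b c by (simp add: p\<beta>)
    also have "\<dots> \<in> \<gamma> ` carrier G0"
      using b c by (intro normal.inv_op_closed2[OF \<gamma>_normal]) simp_all
    finally show "b \<otimes>\<^bsub>B\<^esub> \<epsilon> e \<otimes>\<^bsub>B\<^esub> inv\<^bsub>B\<^esub> b \<in> \<epsilon> ` carrier E0"
      using b c by (simp add: \<epsilon>_image preimage)
  next
    fix k e assume "k \<in> kernel B G p" and "e \<in> carrier E0"
    then obtain a c where a: "a \<in> carrier A0" "k = \<beta> (j0 a)" and c: "c \<in> carrier B0" "\<epsilon> e = \<beta> c"
      using ker_p \<epsilon>_image by blast
    \<comment> \<open>Centrality lives in \<open>B0\<close>; applying \<beta> transports the
      commutation to \<open>B\<close>.\<close>
    have "j0 a \<otimes>\<^bsub>B0\<^esub> c = c \<otimes>\<^bsub>B0\<^esub> j0 a"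
      using central a(1) c(1) by (auto simp: group_center_def)
    then have "\<beta> (j0 a) \<otimes>\<^bsub>B\<^esub> \<beta> c = \<beta> c \<otimes>\<^bsub>B\<^esub> \<beta> (j0 a)"
      using a(1) c(1) j0_closed by (metis \<beta>.hom_mult)
    then show "k \<otimes>\<^bsub>B\<^esub> \<epsilon> e = \<epsilon> e \<otimes>\<^bsub>B\<^esub> k"
      by (simp add: a c)
  qed

  \<comment> \<open>On a coset representative this is the compatibility \<open>p\<beta>\<close>; it
    gives the boundary map the form required by \<open>conj_action_crossed_module\<close>.\<close>
  have "(\<gamma> \<circ> \<pi>) e = p (\<epsilon> e)" if "e \<in> carrier E0" for e
    using that by (auto simp: carrier_E0 \<pi>_coset \<epsilon>_coset p\<beta>)
  then have "crossed_module E0 G (\<gamma> \<circ> \<pi>) \<theta>"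
    unfolding \<theta> by (rule conj_action_crossed_module)
  then show ?thesis
    using K_normal \<pi>_hom \<epsilon>_mon conj_action_hom conj_stable
    by (auto simp: \<theta> lcos \<pi>_coset \<epsilon>_coset conj_action_eq)
qed

end
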